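(* Let $k,\ell$ be positive integers with $(k,\ell)\neq(2,1)$. For each $i\in[k]=\{0,1,\ldots,k-1\}$, let $S_i^k$ be the set of vertices $v=v_0v_1\cdots v_{k\ell-1}$ of $ST^\ell_k$ whose first entry is $v_0=i$. Then $S_i^k$ is an E$^\ell$-set of $ST^\ell_k$, and each D$^\ell$-set with respect to $S_i^k$ is an independent set of $ST^\ell_k$.
   Context: For integers $k\ge 1$, $\ell\ge 1$, the multiset star transposition graph $ST^\ell_k$ has as vertices all strings $v_0v_1\cdots v_{k\ell-1}$ of length $k\ell$ over the alphabet $[k]=\{0,\ldots,k-1\}$ in which each symbol occurs exactly $\ell$ times; two vertices $v,w$ are adjacent iff $w$ is obtained from $v$ by swapping the entries $v_0$ and $v_j$ for some $j\in\{1,\ldots,k\ell-1\}$ with $v_j\neq v_0$. For a graph $G$ and $S\subseteq V(G)$, $S$ is an E$^\ell$-set (efficient dominating$^\ell$-set) if for each $v\in V(G)\setminus S$ there are exactly $\ell$ vertices $v^0,\ldots,v^{\ell-1}\in S$ adjacent to $v$, and, when $\ell>1$, $v$ is the only vertex of $G$ adjacent to all of $v^0,\ldots,v^{\ell-1}$. The set $S(v)=\{v^0,\ldots,v^{\ell-1}\}$ is called the D$^\ell$-set of $v$ with respect to $S$. *)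

theory Defs
  imports "Graph_Theory.Pair_Digraph"
begin

definition swap_first :: "nat \<Rightarrow> 'a list \<Rightarrow> 'a list" where
  "swap_first j v = v[0 := v ! j, j := v ! 0]"

definition multiset_strings :: "nat \<Rightarrow> nat \<Rightarrow> nat list set" where
  "multiset_strings l k =
     {v. length v = k * l \<and> set v \<subseteq> {..<k} \<and> (\<forall>a<k. count_list v a = l)}"

text \<open>A simple graph is represented as a symmetric loop-free digraph, with each edge
  present as two opposite arcs; see \<open>pair_graph_ST\<close> below.\<close>

definition ST :: "nat \<Rightarrow> nat \<Rightarrow> nat list pair_pre_digraph" where
  "ST l k =
     \<lparr> pverts = multiset_strings l k,
       parcs = {(v, w). v \<in> multiset_strings l k \<and> w \<in> multiset_strings l k \<and>
                  (\<exists>j\<in>{1..<k * l}. v ! j \<noteq> v ! 0 \<and> w = swap_first j v)} \<rparr>"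

definition D_set :: "'a pair_pre_digraph \<Rightarrow> 'a set \<Rightarrow> 'a \<Rightarrow> 'a set" where
  "D_set G S v = {u \<in> S. (v, u) \<in> parcs G}"

text \<open>Intended for \<open>l \<ge> 1\<close>, where \<open>card (D_set G S v) = l\<close> forces finiteness.
  That \<open>v\<close> itself is adjacent to all of \<open>D_set G S v\<close> holds by definition, so only
  uniqueness is stated.\<close>

definition E_set :: "nat \<Rightarrow> 'a pair_pre_digraph \<Rightarrow> 'a set \<Rightarrow> bool" where
  "E_set l G S \<longleftrightarrow> S \<subseteq> pverts G \<and>
     (\<forall>v\<in>pverts G - S. card (D_set G S v) = l \<and>
        (l > 1 \<longrightarrow> (\<forall>w\<in>pverts G. (\<forall>u\<in>D_set G S v. (w, u) \<in> parcs G) \<longrightarrow> w = v)))"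

definition independent_set :: "'a pair_pre_digraph \<Rightarrow> 'a set \<Rightarrow> bool" where
  "independent_set G A \<longleftrightarrow> A \<subseteq> pverts G \<and> (\<forall>u\<in>A. \<forall>w\<in>A. (u, w) \<notin> parcs G)"

definition first_entry_set :: "nat \<Rightarrow> nat \<Rightarrow> nat \<Rightarrow> nat list set" where
  "first_entry_set l k i = {v \<in> pverts (ST l k). v ! 0 = i}"

lemma swap_first_swap_first:
  assumes "j < length v"
  shows "swap_first j (swap_first j v) = v"
proof (rule nth_equalityI)
  fix n assume "n < length (swap_first j (swap_first j v))"
  then show "swap_first j (swap_first j v) ! n = v ! n"
    using assms order.strict_trans1[OF le0 assms]
    by (simp add: swap_first_def nth_list_update)
qed (simp add: swap_first_def)

lemma mset_swap_first:
  assumes "j < length v"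
  shows "mset (swap_first j v) = mset v"
  unfolding swap_first_def using assms by (intro mset_swap) auto

lemma swap_first_in_multiset_strings:
  assumes "v \<in> multiset_strings l k" "j < k * l"
  shows "swap_first j v \<in> multiset_strings l k"
proof -
  have m: "mset (swap_first j v) = mset v"
    using assms by (intro mset_swap_first) (simp add: multiset_strings_def)
  have "length (swap_first j v) = length v" "set (swap_first j v) = set v"
    using mset_eq_length[OF m] mset_eq_setD[OF m] by simp_all
  moreover have "count_list (swap_first j v) a = count_list v a" for a
    using arg_cong[OF m, of "\<lambda>M. count M a"] by (simp add: count_mset)
  ultimately show ?thesis using assms(1) by (simp add: multiset_strings_def)
qed

lemma finite_multiset_strings: "finite (multiset_strings l k)"
  by (rule finite_subset[OF _ finite_lists_length_eq[of "{..<k}" "k * l"]])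
    (auto simp: multiset_strings_def)

lemma pair_graph_ST: "pair_graph (ST l k)"
proof
  show "finite (pverts (ST l k))"
    by (simp add: ST_def finite_multiset_strings)
  show "finite (parcs (ST l k))"
    by (rule finite_subset[of _ "multiset_strings l k \<times> multiset_strings l k"])
      (auto simp: ST_def finite_multiset_strings)
  show "fst e \<noteq> snd e" if "e \<in> parcs (ST l k)" for e
  proof -
    from that obtain j where j: "fst e \<in> multiset_strings l k" "1 \<le> j" "j < k * l"
      "fst e ! j \<noteq> fst e ! 0" "snd e = swap_first j (fst e)"
      by (auto simp: ST_def)
    then have "snd e ! j = fst e ! 0"
      by (simp add: swap_first_def multiset_strings_def)
    with j show ?thesis by metis
  qed
  have "(w, v) \<in> parcs (ST l k)" if vw: "(v, w) \<in> parcs (ST l k)" for v w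
  proof -
    from vw obtain j where j: "v \<in> multiset_strings l k" "w \<in> multiset_strings l k"
      "1 \<le> j" "j < k * l" "v ! j \<noteq> v ! 0" "w = swap_first j v"
      by (auto simp: ST_def)
    then have len: "j < length v" by (simp add: multiset_strings_def)
    then have "0 < length v" by linarith
    with len have "w ! j \<noteq> w ! 0" using j by (simp add: swap_first_def nth_list_update)
    moreover have "v = swap_first j w" unfolding j(6) using len by (simp add: swap_first_swap_first)
    ultimately have "\<exists>j\<in>{1..<k * l}. w ! j \<noteq> w ! 0 \<and> v = swap_first j w"
      using j(3,4) by (intro bexI[of _ j] conjI) simp_all
    then show ?thesis using j(1,2) by (simp add: ST_def)
  qed
  then show "symmetric (with_proj (ST l k))"
    by (auto simp: symmetric_def sym_def)
qed (auto simp: ST_def)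

end

theory Submission
  imports Defs
begin

text \<open>A vertex \<open>v\<close> with \<open>v ! 0 \<noteq> i\<close> has one neighbour starting with \<open>i\<close> for each of the \<open>l\<close>
  positions of \<open>i\<close> in \<open>v\<close>. Adjacent vertices have different first entries, so these neighbours
  are pairwise non-adjacent. Let \<open>w\<close> be adjacent to the neighbours obtained from two distinct
  positions \<open>j\<close> and \<open>m\<close>. The neighbour from \<open>m\<close> has entry \<open>i\<close> both at \<open>0\<close> and at \<open>j\<close>, so
  \<open>w ! j = i\<close> whichever swap leads to \<open>w\<close>. The neighbour from \<open>j\<close> has entry \<open>v ! 0 \<noteq> i\<close> at \<open>j\<close>,
  so the swap leading from it to \<open>w\<close> must involve \<open>j\<close>, and this swap gives back \<open>v\<close>.\<close>

lemma length_swap_first [simp]: "length (swap_first j v) = length v"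
  by (simp add: swap_first_def)

lemma nth_swap_first:
  assumes "j < length v" "n < length v"
  shows "swap_first j v ! n = (if n = j then v ! 0 else if n = 0 then v ! j else v ! n)"
  using assms by (auto simp: swap_first_def nth_list_update)

lemma swap_first_nth_0: "j < length v \<Longrightarrow> swap_first j v ! 0 = v ! j"
  by (subst nth_swap_first) auto

lemma card_nth_eq: "card {j. j < length v \<and> v ! j = a} = count_list v a"
  by (simp add: count_list_eq_length_filter length_filter_conv_card eq_commute)

lemma pverts_ST: "pverts (ST l k) = multiset_strings l k"
  by (simp add: ST_def)

lemma length_multiset_strings: "v \<in> multiset_strings l k \<Longrightarrow> length v = k * l"
  by (simp add: multiset_strings_def)

text \<open>A swap keeps the multiset of symbols, so \<open>w\<close> is a vertex as soon as
  \<open>v\<close> is.\<close>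

lemma parcs_ST_iff:
  "(v, w) \<in> parcs (ST l k) \<longleftrightarrow>
     v \<in> multiset_strings l k \<and> (\<exists>j. 0 < j \<and> j < k * l \<and> v ! j \<noteq> v ! 0 \<and> w = swap_first j v)"
  by (auto simp: ST_def Suc_le_eq swap_first_in_multiset_strings)

lemma parcs_ST_sym: "(v, w) \<in> parcs (ST l k) \<Longrightarrow> (w, v) \<in> parcs (ST l k)"
proof -
  interpret pair_graph "ST l k" by (rule pair_graph_ST)
  show "(v, w) \<in> parcs (ST l k) \<Longrightarrow> (w, v) \<in> parcs (ST l k)" by (rule arcs_symmetric)
qed

lemma parcs_ST_first_entry_neq: "(v, w) \<in> parcs (ST l k) \<Longrightarrow> w ! 0 \<noteq> v ! 0"
  by (auto simp: parcs_ST_iff swap_first_nth_0 length_multiset_strings)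

text \<open>Only a swap with a position holding \<open>i\<close> brings \<open>i\<close> to the
  front. As \<open>v ! 0 \<noteq> i\<close>, such a position is nonzero and its entry differs from
  \<open>v ! 0\<close>, so the swap is an arc.\<close>

lemma D_set_first_entry_set:
  assumes v: "v \<in> multiset_strings l k" and "v ! 0 \<noteq> i"
  shows "D_set (ST l k) (first_entry_set l k i) v =
    (\<lambda>j. swap_first j v) ` {j. j < length v \<and> v ! j = i}"
proof -
  have len: "length v = k * l" using v by (rule length_multiset_strings)
  have pos: "0 < j" if "v ! j = i" for j
    using that assms(2) by (cases j) auto
  have "u \<in> D_set (ST l k) (first_entry_set l k i) v \<longleftrightarrow>
      (\<exists>j<k * l. v ! j = i \<and> u = swap_first j v)" for u
  proof
    assume "u \<in> D_set (ST l k) (first_entry_set l k i) v"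
    then show "\<exists>j<k * l. v ! j = i \<and> u = swap_first j v"
      using len by (auto simp: D_set_def first_entry_set_def parcs_ST_iff swap_first_nth_0)
  next
    assume "\<exists>j<k * l. v ! j = i \<and> u = swap_first j v"
    then obtain j where "j < k * l" "v ! j = i" "u = swap_first j v" by blast
    with assms pos[of j] len show "u \<in> D_set (ST l k) (first_entry_set l k i) v"
      unfolding D_set_def first_entry_set_def pverts_ST parcs_ST_iff
      by (auto simp: swap_first_nth_0 swap_first_in_multiset_strings)
  qed
  then show ?thesis by (auto simp: len)
qed

lemma card_D_set_first_entry_set:
  assumes v: "v \<in> multiset_strings l k" and "v ! 0 \<noteq> i" and "i < k"
  shows "card (D_set (ST l k) (first_entry_set l k i) v) = l"
proof -
  have "inj_on (\<lambda>j. swap_first j v) {j. j < length v \<and> v ! j = i}"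
  proof (rule inj_onI, rule ccontr)
    fix j m
    assume *: "j \<in> {j. j < length v \<and> v ! j = i}" "m \<in> {j. j < length v \<and> v ! j = i}"
      "swap_first j v = swap_first m v" "j \<noteq> m"
    have "j \<noteq> 0" using *(1) assms(2) by (intro notI) simp
    \<comment> \<open>Position \<open>j\<close> tells the two strings apart.\<close>
    then have "swap_first j v ! j = v ! 0" "swap_first m v ! j = i"
      using *(1,2,4) by (simp_all add: nth_swap_first)
    with *(3) assms(2) show False by simp
  qed
  then have "card (D_set (ST l k) (first_entry_set l k i) v) = count_list v i"
    by (simp add: D_set_first_entry_set[OF assms(1,2)] card_image card_nth_eq)
  also have "\<dots> = l" using v \<open>i < k\<close> by (simp add: multiset_strings_def)
  finally show ?thesis .
qed

lemma common_neighbour_unique: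
  assumes v: "v \<in> multiset_strings l k" and "v ! 0 \<noteq> i"
    and j: "j < k * l" "v ! j = i" and m: "m < k * l" "v ! m = i" and "j \<noteq> m"
    and wj: "(w, swap_first j v) \<in> parcs (ST l k)"
    and wm: "(w, swap_first m v) \<in> parcs (ST l k)"
  shows "w = v"
proof -
  have len: "length v = k * l" using v by (rule length_multiset_strings)
  have pos: "0 < j" "0 < m" "0 < length v"
    using assms(2) j m len by (auto intro: gr0I)
  \<comment> \<open>Reversing both arcs writes \<open>w\<close> as a swap of each neighbour, so its
    entries can be computed.\<close>
  obtain p where p: "p < k * l" "0 < p" "w = swap_first p (swap_first j v)"
    using parcs_ST_sym[OF wj] by (auto simp: parcs_ST_iff)
  obtain q where q: "q < k * l" "0 < q" "w = swap_first q (swap_first m v)"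
    using parcs_ST_sym[OF wm] by (auto simp: parcs_ST_iff)
  \<comment> \<open>If \<open>q = j\<close>, the swap moves the leading \<open>i\<close> to
    \<open>j\<close>; otherwise the \<open>i\<close> at \<open>j\<close> stays in place.\<close>
  have wq: "w ! j = i"
    using q j m pos len \<open>j \<noteq> m\<close> by (auto simp: nth_swap_first)
  have "p = j"
  proof (rule ccontr)
    assume "p \<noteq> j"
    \<comment> \<open>A swap with \<open>p \<noteq> j\<close> leaves the entry at
      \<open>j > 0\<close> untouched.\<close>
    then have "w ! j = v ! 0"
      using p j pos len by (auto simp: nth_swap_first)
    with wq assms(2) show False by simp
  qed
  with p j len show ?thesis by (simp add: swap_first_swap_first)
qed

text \<open>As \<open>l > 1\<close>, the symbol \<open>i\<close> occurs at two distinct positions of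
  \<open>v\<close>, and the two corresponding neighbours already determine \<open>v\<close>.\<close>

lemma D_set_determines_vertex:
  assumes v: "v \<in> multiset_strings l k" and "v ! 0 \<noteq> i" and "i < k" and "l > 1"
    and w: "\<forall>u\<in>D_set (ST l k) (first_entry_set l k i) v. (w, u) \<in> parcs (ST l k)"
  shows "w = v"
proof -
  have len: "length v = k * l" using v by (rule length_multiset_strings)
  define J where "J = {j. j < k * l \<and> v ! j = i}"
  have "card J = count_list v i"
    using card_nth_eq[of v i] by (simp add: J_def len)
  then have "\<not> card J \<le> Suc 0"
    using v \<open>i < k\<close> \<open>l > 1\<close> by (simp add: multiset_strings_def)
  moreover have "finite J" by (simp add: J_def)
  ultimately obtain j m where jm: "j \<in> J" "m \<in> J" "j \<noteq> m"
    by (auto simp: card_le_Suc0_iff_eq)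
  have "(w, swap_first n v) \<in> parcs (ST l k)" if "n \<in> J" for n
    using w that by (simp add: D_set_first_entry_set[OF assms(1,2)] len J_def)
  with jm show ?thesis
    using common_neighbour_unique[OF assms(1,2), of j m w] by (simp add: J_def)
qed

text \<open>All members start with \<open>i\<close>, whereas every arc changes the first
  entry.\<close>

lemma independent_set_D_set:
  "independent_set (ST l k) (D_set (ST l k) (first_entry_set l k i) v)"
  by (auto simp: independent_set_def D_set_def first_entry_set_def dest: parcs_ST_first_entry_neq)

theorem theorem2:
  fixes k l i :: nat
  assumes "k \<ge> 1" and "l \<ge> 1" and "(k, l) \<noteq> (2, 1)" and "i < k"
  shows "E_set l (ST l k) (first_entry_set l k i) \<and>
    (\<forall>v\<in>pverts (ST l k) - first_entry_set l k i.
       independent_set (ST l k) (D_set (ST l k) (first_entry_set l k i) v))"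
proof -
  have "E_set l (ST l k) (first_entry_set l k i)"
    unfolding E_set_def
  proof (intro conjI ballI impI)
    show "first_entry_set l k i \<subseteq> pverts (ST l k)"
      by (auto simp: first_entry_set_def)
  next
    fix v assume "v \<in> pverts (ST l k) - first_entry_set l k i"
    then have v: "v \<in> multiset_strings l k" "v ! 0 \<noteq> i"
      by (auto simp: first_entry_set_def pverts_ST)
    show "card (D_set (ST l k) (first_entry_set l k i) v) = l"
      using v \<open>i < k\<close> by (rule card_D_set_first_entry_set)
    show "w = v" if "l > 1" "\<forall>u\<in>D_set (ST l k) (first_entry_set l k i) v. (w, u) \<in> parcs (ST l k)"
      for w
      using v \<open>i < k\<close> that by (rule D_set_determines_vertex)
  qed
  then show ?thesis by (simp add: independent_set_D_set)
qed

end
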